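(* Let $k\ge1$, let $\beta_1,\ldots,\beta_k$ be negative real numbers, let $(\alpha_n)$ be a sequence of real numbers with $\alpha_n\to\infty$, and let $\mathbb{P}^{(n)}$ be the directed exponential random graph measure with outward-star parameters $\beta_p^{(n)}=\beta_p\alpha_n$, $p=1,\ldots,k$ (defined in the context). Assume that $\liminf_{n\to\infty}\frac{\alpha_n}{n}>\frac{\log 2}{|\beta_1|}$. Then for every fixed vertex $i$, $$\lim_{n\to\infty}\frac{\mathbb{P}^{(n)}(X_{1i}=1)}{\exp\left[n\alpha_n\sum_{p=1}^k\beta_p\left(\frac1n\right)^p\right]}=1.$$
   Context: Directed graphs $G_n$ on the vertex set $\{1,\ldots,n\}$, with loops allowed, are represented by matrices $X_n=(X_{ij})_{1\le i,j\le n}$ with $X_{ij}\in\{0,1\}$, where $X_{ij}=1$ if and only if there is a directed edge from $i$ to $j$. For $p\ge1$ the directed $p$-star homomorphism density is $$s_p(X_n)=n^{-p-1}\sum_{1\le i,j_1,\ldots,j_p\le n}X_{ij_1}X_{ij_2}\cdots X_{ij_p}=n^{-p-1}\sum_{i=1}^n\left(\sum_{j=1}^nX_{ij}\right)^p.$$ The measure $\mathbb{P}^{(n)}$ on $\{0,1\}^{n\times n}$ is $$\mathbb{P}^{(n)}(G_n)=Z_n^{-1}\exp\left[n^2\sum_{p=1}^k\beta_p^{(n)}s_p(X_n)\right],\qquad \beta_p^{(n)}=\beta_p\alpha_n,$$ where $Z_n=\sum_{X_n\in\{0,1\}^{n\times n}}\exp\left[n^2\sum_{p=1}^k\beta_p^{(n)}s_p(X_n)\right]$.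 *)

theory Defs
  imports "HOL-Probability.Probability"
begin

text \<open>The vertex set is \<open>{1..n}\<close>; loops are allowed. The adjacency matrices are
  taken as extensional functions on \<open>{1..n} \<times> {1..n}\<close>, so that each matrix is represented
  exactly once.\<close>

definition digraphs :: "nat \<Rightarrow> (nat \<times> nat \<Rightarrow> real) set" where
  "digraphs n = ({1..n} \<times> {1..n}) \<rightarrow>\<^sub>E {0, 1}"

text \<open>The multi-index \<open>(j\<^sub>1, \<dots>, j\<^sub>p)\<close> is the function \<open>j\<close> on \<open>{1..p}\<close>.\<close>

definition star_density :: "nat \<Rightarrow> nat \<Rightarrow> (nat \<times> nat \<Rightarrow> real) \<Rightarrow> real" where
  "star_density n p X =
     (\<Sum>i\<in>{1..n}. \<Sum>j\<in>{1..p} \<rightarrow>\<^sub>E {1..n}. \<Prod>q\<in>{1..p}. X (i, j q)) / real n ^ (p + 1)"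

lemma star_density_outdegree:
  "star_density n p X = (\<Sum>i\<in>{1..n}. (\<Sum>j\<in>{1..n}. X (i, j)) ^ p) / real n ^ (p + 1)"
proof -
  have "(\<Sum>j\<in>{1..p} \<rightarrow>\<^sub>E {1..n}. \<Prod>q\<in>{1..p}. X (i, j q)) = (\<Sum>j\<in>{1..n}. X (i, j)) ^ p" for i
    using prod_sum_PiE[of "{1..p}" "\<lambda>_. {1..n}" "\<lambda>q j. X (i, j)"] by simp
  then show ?thesis
    by (simp add: star_density_def)
qed

definition star_weight :: "nat \<Rightarrow> nat \<Rightarrow> (nat \<Rightarrow> real) \<Rightarrow> (nat \<times> nat \<Rightarrow> real) \<Rightarrow> real" where
  "star_weight n k b X = exp (real n ^ 2 * (\<Sum>p = 1..k. b p * star_density n p X))"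

definition star_partition :: "nat \<Rightarrow> nat \<Rightarrow> (nat \<Rightarrow> real) \<Rightarrow> real" where
  "star_partition n k b = (\<Sum>X\<in>digraphs n. star_weight n k b X)"

definition star_ergm :: "nat \<Rightarrow> nat \<Rightarrow> (nat \<Rightarrow> real) \<Rightarrow> (nat \<times> nat \<Rightarrow> real) measure" where
  "star_ergm n k b =
     point_measure (digraphs n) (\<lambda>X. ennreal (star_weight n k b X / star_partition n k b))"

lemma finite_digraphs: "finite (digraphs n)"
  by (auto simp: digraphs_def intro!: finite_PiE)

lemma star_partition_pos: "star_partition n k b > 0"
proof -
  have "digraphs n \<noteq> {}"
    by (auto simp: digraphs_def PiE_eq_empty_iff)
  then show ?thesis
    by (auto simp: star_partition_def star_weight_def intro!: sum_pos finite_digraphs)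
qed

lemma prob_space_star_ergm: "prob_space (star_ergm n k b)"
proof -
  have "(\<Sum>X\<in>digraphs n. star_weight n k b X / star_partition n k b) = 1"
    using star_partition_pos[of n k b]
    by (simp add: star_partition_def flip: sum_divide_distrib)
  moreover have "star_weight n k b X / star_partition n k b \<ge> 0" for X
    using star_partition_pos[of n k b] by (simp add: star_weight_def)
  ultimately show ?thesis
    unfolding star_ergm_def
    by (intro prob_spaceI)
      (simp add: space_point_measure emeasure_point_measure_finite finite_digraphs sum_ennreal)
qed

end

theory Submission
  imports Defs "HOL-Real_Asymp.Real_Asymp"
begin

text \<open>The weight of a digraph is a product over its rows of a function of the outdegree, so the rows
  are independent and \<open>P(X\<^sub>1\<^sub>i = 1) = A / B\<close>, where \<open>B\<close> is the total weight of all rows and \<open>A\<close>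
  that of the rows with an edge to \<open>i\<close>. A row of outdegree \<open>d\<close> has weight \<open>exp (\<phi> d)\<close>; for
  \<open>c = \<beta>\<^sub>1 \<alpha>\<^sub>n\<close> the negativity of the parameters gives \<open>\<phi> d \<le> c d\<close> and \<open>\<phi> d - \<phi> 1 \<le> c (d - 1)\<close>
  for \<open>d \<ge> 1\<close>. Comparing with independent edges, both \<open>B\<close> and \<open>A / exp (\<phi> 1)\<close> lie between
  \<open>1\<close> and \<open>(1 + exp c)\<^sup>n\<close>. The growth of \<open>\<alpha>\<^sub>n\<close> gives \<open>exp c \<le> 2\<^sup>-\<^sup>n\<close>, and
  \<open>(1 + 2\<^sup>-\<^sup>n)\<^sup>n\<close> tends to \<open>1\<close>.\<close>

section \<open>Factorization over rows\<close>

text \<open>Currying identifies a matrix with the family of its rows, after which distributivity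
  applies. The sets \<open>F r j\<close> may vary with the cell, so that single entries can be
  prescribed.\<close>

lemma sum_PiE_Times_prod:
  fixes g :: "'a \<Rightarrow> ('b \<Rightarrow> 'c) \<Rightarrow> 'd :: comm_semiring_1"
  assumes "finite I" "finite J" "\<And>r j. r \<in> I \<Longrightarrow> j \<in> J \<Longrightarrow> finite (F r j)"
  shows "(\<Sum>X\<in>PiE (I \<times> J) (\<lambda>(r, j). F r j). \<Prod>r\<in>I. g r (\<lambda>j\<in>J. X (r, j)))
       = (\<Prod>r\<in>I. \<Sum>x\<in>PiE J (F r). g r x)"
proof -
  have "(\<Prod>r\<in>I. \<Sum>x\<in>PiE J (F r). g r x) = (\<Sum>Y\<in>PiE I (\<lambda>r. PiE J (F r)). \<Prod>r\<in>I. g r (Y r))"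
    using assms by (intro prod_sum_PiE) (auto intro: finite_PiE)
  also have "\<dots> = (\<Sum>X\<in>PiE (I \<times> J) (\<lambda>(r, j). F r j). \<Prod>r\<in>I. g r (\<lambda>j\<in>J. X (r, j)))"
  \<comment> \<open>The restrictions keep both maps extensional; without them they would not be
    mutually inverse outside the index sets.\<close>
  proof (rule sum.reindex_bij_witness[where i = "\<lambda>X. \<lambda>r\<in>I. \<lambda>j\<in>J. X (r, j)"
        and j = "\<lambda>Y. \<lambda>(r, j)\<in>I \<times> J. Y r j"])
    fix Y assume Y: "Y \<in> PiE I (\<lambda>r. PiE J (F r))"
    have row: "(\<lambda>j\<in>J. (\<lambda>(r, j)\<in>I \<times> J. Y r j) (r, j)) = Y r" if "r \<in> I" for r
      using Y that by (intro ext) (auto simp: PiE_iff extensional_def restrict_def)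
    show "(\<lambda>r\<in>I. \<lambda>j\<in>J. (\<lambda>(r, j)\<in>I \<times> J. Y r j) (r, j)) = Y"
      using Y row by (intro ext) (auto simp: restrict_def[of _ I] PiE_iff extensional_def[of I])
    show "(\<lambda>(r, j)\<in>I \<times> J. Y r j) \<in> PiE (I \<times> J) (\<lambda>(r, j). F r j)"
      using Y by (auto simp: PiE_iff)
    show "(\<Prod>r\<in>I. g r (\<lambda>j\<in>J. (\<lambda>(r, j)\<in>I \<times> J. Y r j) (r, j))) = (\<Prod>r\<in>I. g r (Y r))"
      using row by (intro prod.cong) auto
  next
    fix X assume X: "X \<in> PiE (I \<times> J) (\<lambda>(r, j). F r j)"
    show "(\<lambda>(r, j)\<in>I \<times> J. (\<lambda>r\<in>I. \<lambda>j\<in>J. X (r, j)) r j) = X"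
      using PiE_arb[OF X] by (intro ext) (auto simp: restrict_def)
    show "(\<lambda>r\<in>I. \<lambda>j\<in>J. X (r, j)) \<in> PiE I (\<lambda>r. PiE J (F r))"
      using X by (auto simp: PiE_iff)
  qed
  finally show ?thesis ..
qed

text \<open>The share of a row of outdegree \<open>d\<close> in the exponent of
  \<open>star_weight\<close>: the factor \<open>n^2 / n^(p+1)\<close> turns \<open>d^p\<close> into
  \<open>n * (d/n)^p\<close>.\<close>

definition row_energy :: "nat \<Rightarrow> nat \<Rightarrow> (nat \<Rightarrow> real) \<Rightarrow> real \<Rightarrow> real" where
  "row_energy n k b d = real n * (\<Sum>p = 1..k. b p * (d / real n) ^ p)"

definition row_weight :: "nat \<Rightarrow> nat \<Rightarrow> (nat \<Rightarrow> real) \<Rightarrow> (nat \<Rightarrow> real) \<Rightarrow> real" where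
  "row_weight n k b x = exp (row_energy n k b (\<Sum>j\<in>{1..n}. x j))"

definition row_partition :: "nat \<Rightarrow> nat \<Rightarrow> (nat \<Rightarrow> real) \<Rightarrow> real" where
  "row_partition n k b = (\<Sum>x\<in>{1..n} \<rightarrow>\<^sub>E {0, 1}. row_weight n k b x)"

text \<open>Writing the condition as a singleton factor keeps this a product set, so exponential
  sums over it factor by columns.\<close>

definition edge_rows :: "nat \<Rightarrow> nat \<Rightarrow> (nat \<Rightarrow> real) set" where
  "edge_rows n i = PiE {1..n} (\<lambda>j. if j = i then {1} else {0, 1})"

lemma star_weight_eq_prod:
  assumes "n > 0"
  shows "star_weight n k b X = (\<Prod>r\<in>{1..n}. row_weight n k b (\<lambda>j\<in>{1..n}. X (r, j)))"
proof -
  have "(real n)\<^sup>2 * (\<Sum>p = 1..k. b p * star_density n p X)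
      = (\<Sum>p = 1..k. (real n)\<^sup>2 * (b p * star_density n p X))"
    by (rule sum_distrib_left)
  also have "\<dots>
      = (\<Sum>p = 1..k. \<Sum>r\<in>{1..n}. real n * (b p * ((\<Sum>j\<in>{1..n}. X (r, j)) / real n) ^ p))"
    using assms
    by (intro sum.cong)
      (simp_all add: star_density_outdegree sum_distrib_left power_divide power2_eq_square field_simps
        flip: sum_distrib_left sum_divide_distrib)
  also have "\<dots> = (\<Sum>r\<in>{1..n}. row_energy n k b (\<Sum>j\<in>{1..n}. X (r, j)))"
    by (subst sum.swap) (simp add: row_energy_def sum_distrib_left)
  finally show ?thesis
    by (simp add: star_weight_def row_weight_def exp_sum)
qed

lemma star_partition_eq_power:
  assumes "n > 0"
  shows "star_partition n k b = row_partition n k b ^ n"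
proof -
  have "digraphs n = PiE ({1..n} \<times> {1..n}) (\<lambda>(r, j). {0, 1})"
    by (simp add: digraphs_def case_prod_unfold)
  then show ?thesis
    using sum_PiE_Times_prod[of "{1..n}" "{1..n}" "\<lambda>_ _. {0, 1}" "\<lambda>_. row_weight n k b"] assms
    by (simp add: star_partition_def star_weight_eq_prod row_partition_def)
qed

text \<open>The event constrains row 1 alone; each of the other \<open>n - 1\<close> rows ranges
  freely and contributes \<open>row_partition\<close>.\<close>

lemma sum_star_weight_edge:
  assumes "n > 0" "i \<in> {1..n}"
  shows "(\<Sum>X | X \<in> digraphs n \<and> X (1, i) = 1. star_weight n k b X)
       = (\<Sum>x\<in>edge_rows n i. row_weight n k b x) * row_partition n k b ^ (n - 1)"
proof -
  \<comment> \<open>The event becomes a product set in which only the cell \<open>(1, i)\<close> is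
    forced.\<close>
  let ?F = "\<lambda>r j. if r = (1 :: nat) \<and> j = i then {1} else {0, 1 :: real}"
  have "{X \<in> digraphs n. X (1, i) = 1} = PiE ({1..n} \<times> {1..n}) (\<lambda>(r, j). ?F r j)"
  proof (intro subset_antisym subsetI)
    fix X assume X: "X \<in> PiE ({1..n} \<times> {1..n}) (\<lambda>(r, j). ?F r j)"
    have "(1, i) \<in> {1..n} \<times> {1..n}" using assms by auto
    from PiE_mem[OF X this] have "X (1, i) = 1" by simp
    moreover have "X \<in> digraphs n"
      using X unfolding digraphs_def PiE_iff by (auto split: if_splits)
    ultimately show "X \<in> {X \<in> digraphs n. X (1, i) = 1}" by simp
  qed (auto simp: digraphs_def PiE_iff)
  then have "(\<Sum>X | X \<in> digraphs n \<and> X (1, i) = 1. star_weight n k b X)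
      = (\<Prod>r\<in>{1..n}. \<Sum>x\<in>PiE {1..n} (?F r). row_weight n k b x)"
    using sum_PiE_Times_prod[of "{1..n}" "{1..n}" ?F "\<lambda>_. row_weight n k b"] assms
    by (simp add: star_weight_eq_prod)
  also have "\<dots> = (\<Sum>x\<in>PiE {1..n} (?F 1). row_weight n k b x)
      * (\<Prod>r\<in>{1..n} - {1}. \<Sum>x\<in>PiE {1..n} (?F r). row_weight n k b x)"
    using assms by (intro prod.remove) auto
  also have "(\<Prod>r\<in>{1..n} - {1}. \<Sum>x\<in>PiE {1..n} (?F r). row_weight n k b x)
      = (\<Prod>r\<in>{1..n} - {1}. row_partition n k b)"
    by (intro prod.cong) (auto simp: row_partition_def)
  also have "\<dots> = row_partition n k b ^ (n - 1)"
    using assms by simp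
  finally show ?thesis
    by (simp add: edge_rows_def)
qed

lemma measure_star_ergm_edge:
  assumes "n > 0" "i \<in> {1..n}"
  shows "measure (star_ergm n k b) {X \<in> space (star_ergm n k b). X (1, i) = 1}
       = (\<Sum>x\<in>edge_rows n i. row_weight n k b x) / row_partition n k b"
proof -
  have nonneg: "0 \<le> star_weight n k b X / star_partition n k b" for X
    using star_partition_pos[of n k b] by (simp add: star_weight_def)
  have "row_partition n k b \<noteq> 0"
    using star_partition_pos[of n k b] assms(1) by (auto simp: star_partition_eq_power zero_power)
  moreover have "row_partition n k b ^ n = row_partition n k b * row_partition n k b ^ (n - 1)"
    using assms(1) by (metis power_eq_if less_irrefl)
  moreover have "measure (star_ergm n k b) {X \<in> space (star_ergm n k b). X (1, i) = 1}
      = (\<Sum>X | X \<in> digraphs n \<and> X (1, i) = 1. star_weight n k b X / star_partition n k b)"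
    unfolding star_ergm_def
    by (subst measure_point_measure_finite_if)
      (auto simp: space_point_measure finite_digraphs nonneg)
  ultimately show ?thesis
    using assms by (simp add: sum_star_weight_edge star_partition_eq_power flip: sum_divide_distrib
        del: One_nat_def)
qed

section \<open>Bounds for a single row\<close>

text \<open>Powers are monotone on nonnegative reals and every \<open>b p\<close> is nonpositive, so
  the terms with \<open>p > 1\<close> only lower the difference; the linear term remains.\<close>

lemma row_energy_diff_le:
  assumes "n > 0" "k \<ge> 1" "\<And>p. p \<in> {1..k} \<Longrightarrow> b p \<le> 0" "0 \<le> d" "d \<le> e"
  shows "row_energy n k b e - row_energy n k b d \<le> b 1 * (e - d)"
proof -
  have "(\<Sum>p = 1..k. b p * ((e / n) ^ p - (d / n) ^ p))
      \<le> (\<Sum>p = 1..k. if p = 1 then b 1 * (e / n - d / n) else 0)"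
    using assms
    by (intro sum_mono)
      (auto intro!: mult_nonpos_nonneg power_mono divide_right_mono simp del: One_nat_def)
  also have "\<dots> = b 1 * (e / n - d / n)"
    using assms(2) by simp
  finally have "real n * (\<Sum>p = 1..k. b p * ((e / n) ^ p - (d / n) ^ p)) \<le> real n * (b 1 * (e / n - d / n))"
    by (intro mult_left_mono) auto
  also have "\<dots> = b 1 * (e - d)"
    using assms(1) by (simp add: field_simps)
  finally show ?thesis
    by (simp add: row_energy_def right_diff_distrib sum_subtractf)
qed

lemma row_energy_0: "row_energy n k b 0 = 0"
  unfolding row_energy_def by (simp add: sum.neutral)

lemma sum_PiE_exp:
  fixes c :: real
  assumes "finite J" "\<And>j. j \<in> J \<Longrightarrow> finite (F j)"
  shows "(\<Sum>x\<in>PiE J F. exp (c * (\<Sum>j\<in>J. x j))) = (\<Prod>j\<in>J. \<Sum>a\<in>F j. exp (c * a))"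
  using assms by (simp add: prod_sum_PiE sum_distrib_left exp_sum)

text \<open>The empty row alone gives the lower bound. The upper one compares each outdegree with 0,
  which leaves independent edges of weight \<open>exp (b 1)\<close>.\<close>

lemma row_partition_bounds:
  assumes "n > 0" "k \<ge> 1" "\<And>p. p \<in> {1..k} \<Longrightarrow> b p \<le> 0"
  shows "1 \<le> row_partition n k b" "row_partition n k b \<le> (1 + exp (b 1)) ^ n"
proof -
  have "row_weight n k b (\<lambda>j\<in>{1..n}. 0) \<le> row_partition n k b"
    unfolding row_partition_def
    by (rule member_le_sum) (auto simp: row_weight_def intro!: finite_PiE)
  then show "1 \<le> row_partition n k b"
    by (simp add: row_weight_def row_energy_0)
  have "row_partition n k b \<le> (\<Sum>x\<in>{1..n} \<rightarrow>\<^sub>E {0, 1}. exp (b 1 * (\<Sum>j\<in>{1..n}. x j)))"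
    unfolding row_partition_def row_weight_def
  proof (intro sum_mono)
    fix x :: "nat \<Rightarrow> real" assume "x \<in> {1..n} \<rightarrow>\<^sub>E {0, 1}"
    then have "0 \<le> (\<Sum>j\<in>{1..n}. x j)"
      by (intro sum_nonneg) (drule (1) PiE_mem, auto)
    then show "exp (row_energy n k b (\<Sum>j\<in>{1..n}. x j)) \<le> exp (b 1 * (\<Sum>j\<in>{1..n}. x j))"
      using row_energy_diff_le[OF assms, where d = 0 and e = "\<Sum>j\<in>{1..n}. x j"] by (simp add: row_energy_0)
  qed
  then show "row_partition n k b \<le> (1 + exp (b 1)) ^ n"
    by (simp add: sum_PiE_exp)
qed

lemma edge_rows_sum_bounds:
  assumes "n > 0" "k \<ge> 1" "\<And>p. p \<in> {1..k} \<Longrightarrow> b p \<le> 0" "i \<in> {1..n}"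
  defines "R \<equiv> (\<Sum>x\<in>edge_rows n i. row_weight n k b x) / exp (row_energy n k b 1)"
  shows "1 \<le> R" "R \<le> (1 + exp (b 1)) ^ n"
proof -
  \<comment> \<open>The row whose only edge goes to \<open>i\<close> has outdegree 1, hence
    contributes exactly 1 to \<open>R\<close>.\<close>
  define e where "e = (\<lambda>j\<in>{1..n}. if j = i then 1 else 0 :: real)"
  have "row_weight n k b e \<le> (\<Sum>x\<in>edge_rows n i. row_weight n k b x)"
    by (rule member_le_sum) (auto simp: row_weight_def edge_rows_def e_def intro!: finite_PiE)
  moreover have "(\<Sum>j\<in>{1..n}. e j) = 1"
    using assms(4) by (simp add: e_def)
  ultimately show "1 \<le> R"
    by (simp add: row_weight_def R_def)
  have "R \<le> (\<Sum>x\<in>edge_rows n i. exp (- b 1) * exp (b 1 * (\<Sum>j\<in>{1..n}. x j)))"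
    unfolding R_def sum_divide_distrib
  proof (intro sum_mono)
    fix x assume x: "x \<in> edge_rows n i"
    have "x i = 1"
      using PiE_mem[OF x[unfolded edge_rows_def] assms(4)] by simp
    \<comment> \<open>The forced edge makes the outdegree at least 1, as the comparison with
      \<open>d = 1\<close> requires.\<close>
    moreover have "x i \<le> (\<Sum>j\<in>{1..n}. x j)"
      using x assms(4)
      by (intro member_le_sum) (force simp: edge_rows_def PiE_iff split: if_splits)+
    ultimately have "row_energy n k b (\<Sum>j\<in>{1..n}. x j) - row_energy n k b 1
        \<le> - b 1 + b 1 * (\<Sum>j\<in>{1..n}. x j)"
      using row_energy_diff_le[OF assms(1-3), where d = 1 and e = "\<Sum>j\<in>{1..n}. x j"]
      by (simp add: algebra_simps)
    then show "row_weight n k b x / exp (row_energy n k b 1)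
        \<le> exp (- b 1) * exp (b 1 * (\<Sum>j\<in>{1..n}. x j))"
      unfolding row_weight_def by (simp flip: exp_diff exp_add)
  qed
  \<comment> \<open>Column \<open>i\<close> admits only the value 1; its factor
    \<open>exp (b 1)\<close> will cancel the prefactor.\<close>
  also have "\<dots> = exp (- b 1) * (\<Prod>j\<in>{1..n}. if j = i then exp (b 1) else 1 + exp (b 1))"
    unfolding edge_rows_def sum_distrib_left[symmetric]
    by (subst sum_PiE_exp) (auto intro!: prod.cong)
  also have "(\<Prod>j\<in>{1..n}. if j = i then exp (b 1) else 1 + exp (b 1))
      = exp (b 1) * (\<Prod>j\<in>{1..n} - {i}. if j = i then exp (b 1) else 1 + exp (b 1))"
    using prod.remove[OF _ assms(4), of "\<lambda>j. if j = i then exp (b 1) else 1 + exp (b 1)"] by simp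
  also have "(\<Prod>j\<in>{1..n} - {i}. if j = i then exp (b 1) else 1 + exp (b 1))
      = (1 + exp (b 1)) ^ (n - 1)"
    using assms(4) by (subst prod.cong[OF refl, where h = "\<lambda>_. 1 + exp (b 1)"]) auto
  also have "exp (- b 1) * (exp (b 1) * (1 + exp (b 1)) ^ (n - 1)) = (1 + exp (b 1)) ^ (n - 1)"
    by (simp add: exp_minus)
  \<comment> \<open>Enlarging the exponent gives the same bound as for \<open>row_partition\<close>,
    so one limit serves both.\<close>
  also have "\<dots> \<le> (1 + exp (b 1)) ^ n"
    by (intro power_increasing) auto
  finally show "R \<le> (1 + exp (b 1)) ^ n" .
qed

section \<open>Passage to the limit\<close>

theorem theorem3p4:
  fixes k :: nat and \<beta> :: "nat \<Rightarrow> real" and \<alpha> :: "nat \<Rightarrow> real" and i :: nat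
  assumes "k \<ge> 1"
    and "\<And>p. p \<in> {1..k} \<Longrightarrow> \<beta> p < 0"
    and "filterlim \<alpha> at_top sequentially"
    and "liminf (\<lambda>n. ereal (\<alpha> n / real n)) > ereal (ln 2 / \<bar>\<beta> 1\<bar>)"
    and "i \<ge> 1"
  shows "(\<lambda>n. measure (star_ergm n k (\<lambda>p. \<beta> p * \<alpha> n))
                {X \<in> space (star_ergm n k (\<lambda>p. \<beta> p * \<alpha> n)). X (1, i) = 1}
              / exp (real n * \<alpha> n * (\<Sum>p = 1..k. \<beta> p * (1 / real n) ^ p)))
           \<longlonglongrightarrow> 1"
proof -
  define b where "b n = (\<lambda>p. \<beta> p * \<alpha> n)" for n
  define B where "B n = row_partition n k (b n)" for n
  define R where "R n = (\<Sum>x\<in>edge_rows n i. row_weight n k (b n) x)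
      / exp (row_energy n k (b n) 1)" for n
  have \<beta>1: "\<beta> 1 < 0"
    using assms(1,2) by simp
  have "eventually (\<lambda>n. ereal (ln 2 / \<bar>\<beta> 1\<bar>) < ereal (\<alpha> n / real n)) sequentially"
    using assms(4) by (rule less_LiminfD)
  \<comment> \<open>Nonnegative \<open>\<alpha> n\<close> makes all scaled parameters nonpositive,
    as the row bounds require.\<close>
  moreover have "eventually (\<lambda>n. \<alpha> n \<ge> 0) sequentially"
    using assms(3) by (simp add: filterlim_at_top)
  moreover have "eventually (\<lambda>n. n \<ge> i) sequentially"
    by (rule eventually_ge_at_top)
  ultimately have ev: "eventually (\<lambda>n. n > 0 \<and> i \<in> {1..n} \<and> (\<forall>p\<in>{1..k}. b n p \<le> 0)
      \<and> exp (b n 1) \<le> 1 / 2 ^ n) sequentially"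
  proof eventually_elim
    case (elim n)
    have n: "n > 0" using elim assms(5) by simp
    \<comment> \<open>The threshold in the liminf condition is the one that yields
      \<open>b n 1 \<le> - n * ln 2\<close>.\<close>
    have "ln 2 * real n \<le> \<alpha> n * \<bar>\<beta> 1\<bar>"
      using elim(1) n \<beta>1 by (simp add: field_simps)
    then have "b n 1 \<le> - (real n * ln 2)"
      using \<beta>1 by (simp add: b_def algebra_simps)
    then have "exp (b n 1) \<le> exp (- (real n * ln 2))"
      by simp
    also have "\<dots> = 1 / 2 ^ n"
      by (simp add: exp_minus exp_of_nat_mult field_simps)
    finally show ?case
      using n elim assms(2,5) by (auto simp: b_def intro!: mult_nonpos_nonneg intro: less_imp_le)
  qed
  \<comment> \<open>The logarithm is at most \<open>n / 2 ^ n\<close>, which tends to 0.\<close>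
  have lim: "(\<lambda>n. (1 + 1 / 2 ^ n) ^ n :: real) \<longlonglongrightarrow> 1"
    by real_asymp
  have pow: "(1 + exp c) ^ n \<le> (1 + 1 / 2 ^ n) ^ n" if "exp c \<le> 1 / 2 ^ n" for c :: real and n
    using that by (intro power_mono) (auto simp: add_nonneg_nonneg)
  have "eventually (\<lambda>n. 1 \<le> B n \<and> B n \<le> (1 + 1 / 2 ^ n) ^ n) sequentially"
    using ev
  proof eventually_elim
    case (elim n)
    then show ?case
      unfolding B_def using assms(1)
      by (blast intro: row_partition_bounds(1) order_trans[OF row_partition_bounds(2) pow])
  qed
  then have B: "B \<longlonglongrightarrow> 1"
    by (intro tendsto_sandwich[OF _ _ tendsto_const lim]) (auto elim: eventually_mono)
  have "eventually (\<lambda>n. 1 \<le> R n \<and> R n \<le> (1 + 1 / 2 ^ n) ^ n) sequentially"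
    using ev
  proof eventually_elim
    case (elim n)
    then show ?case
      unfolding R_def using assms(1)
      by (blast intro: edge_rows_sum_bounds(1) order_trans[OF edge_rows_sum_bounds(2) pow])
  qed
  then have R: "R \<longlonglongrightarrow> 1"
    by (intro tendsto_sandwich[OF _ _ tendsto_const lim]) (auto elim: eventually_mono)
  have "(\<lambda>n. R n / B n) \<longlonglongrightarrow> 1"
    using tendsto_divide[OF R B] by simp
  moreover have "eventually (\<lambda>n. R n / B n =
      measure (star_ergm n k (b n)) {X \<in> space (star_ergm n k (b n)). X (1, i) = 1}
      / exp (real n * \<alpha> n * (\<Sum>p = 1..k. \<beta> p * (1 / real n) ^ p))) sequentially"
    using ev
  proof eventually_elim
    case (elim n)
    \<comment> \<open>The normalizing exponent of the theorem is the energy of a row with a single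
      edge, by which \<open>R\<close> is already divided.\<close>
    have "row_energy n k (b n) 1 = real n * \<alpha> n * (\<Sum>p = 1..k. \<beta> p * (1 / real n) ^ p)"
      by (simp add: row_energy_def b_def sum_distrib_left mult_ac)
    then show ?case
      using elim by (simp add: measure_star_ergm_edge R_def B_def del: One_nat_def)
  qed
  ultimately show ?thesis
    unfolding b_def by (rule Lim_transform_eventually)
qed

end
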